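(* For all integers $n\geq 3$ and all $q\in\{123,321,213,231\}\subseteq S_3$, we have $$|S_n^{(3)}(q:q^{(2)}:q^{(3)})|=5n-10.$$
   Context: $S_n$ denotes the set of permutations $p=p(1)p(2)\cdots p(n)$ of $\{1,2,\ldots,n\}$ in one-line notation. For $p\in S_n$ and $q\in S_m$, $p$ contains $q$ as a pattern if there exist $1\leq i_1<\cdots<i_m\leq n$ such that for all $1\leq a<b\leq m$, $p(i_a)<p(i_b)$ if and only if $q(a)<q(b)$; otherwise $p$ avoids $q$. The rotations of $p\in S_n$ are $p^{(1)}=p$ and, for $i\in\{2,\ldots,n\}$, $p^{(i)}=p(i)p(i+1)\cdots p(n)p(1)p(2)\cdots p(i-1)$; the same notation is used for patterns, e.g. for $q=q(1)q(2)q(3)\in S_3$, $q^{(2)}=q(2)q(3)q(1)$ and $q^{(3)}=q(3)q(1)q(2)$. For $q_1,q_2,q_3\in S_3$, $S_n^{(3)}(q_1:q_2:q_3)$ is the set of $p\in S_n$ such that $p^{(i)}$ avoids $q_i$ for all $i\in\{1,2,3\}$. *)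

theory Defs
  imports "HOL-Combinatorics.Combinatorics"
begin

text \<open>
  Permutations in one-line notation are lists: \<open>p = [p(1), \<dots>, p(n)]\<close> with entries in
  \<open>{1..n}\<close>. List positions count from 0, so \<open>p(i)\<close> is \<open>p ! (i - 1)\<close>.
\<close>

definition Sym :: "nat \<Rightarrow> nat list set" where
  "Sym n = permutations_of_set {1..n}"

text \<open>The function \<open>f\<close> lists the positions \<open>i\<^sub>1 < \<dots> < i\<^sub>m\<close> of the occurrence of \<open>q\<close> in \<open>p\<close>.\<close>

definition contains_pattern :: "nat list \<Rightarrow> nat list \<Rightarrow> bool" where
  "contains_pattern p q \<longleftrightarrow>
     (\<exists>f. strict_mono_on {..<length q} f \<and> f ` {..<length q} \<subseteq> {..<length p} \<and>
          (\<forall>a b. a < b \<and> b < length q \<longrightarrow> (p ! f a < p ! f b \<longleftrightarrow> q ! a < q ! b)))"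

definition avoids :: "nat list \<Rightarrow> nat list \<Rightarrow> bool" where
  "avoids p q \<longleftrightarrow> \<not> contains_pattern p q"

text \<open>
  \<open>rotation i p\<close> is \<open>p\<^sup>(\<^sup>i\<^sup>) = p(i) \<dots> p(n) p(1) \<dots> p(i - 1)\<close>, for \<open>1 \<le> i \<le> n\<close>; in particular
  \<open>rotation 1 p = p\<close>.
\<close>

definition rotation :: "nat \<Rightarrow> nat list \<Rightarrow> nat list" where
  "rotation i p = rotate (i - 1) p"

definition Sym3_avoiding :: "nat \<Rightarrow> nat list \<Rightarrow> nat list \<Rightarrow> nat list \<Rightarrow> nat list set" where
  "Sym3_avoiding n q\<^sub>1 q\<^sub>2 q\<^sub>3 =
     {p \<in> Sym n. avoids (rotation 1 p) q\<^sub>1 \<and> avoids (rotation 2 p) q\<^sub>2 \<and> avoids (rotation 3 p) q\<^sub>3}"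

end

theory Submission
  imports Defs
begin

text \<open>
  Write \<open>p = a b r\<close>. A triple of entries of \<open>p\<close> is rotated along with the pattern exactly when it
  is carried past the end of the list, so the three avoidance conditions turn into conditions on
  triples of \<open>p\<close>: \<open>a b x\<close> avoids \<open>q\<close>, both \<open>a x y\<close> and \<open>b x y\<close> avoid \<open>q\<close> and \<open>q\<^sup>(\<^sup>2\<^sup>)\<close>, and \<open>r\<close> avoids
  all three rotations of \<open>q\<close>. Complementing \<open>p\<close> exchanges \<open>123\<close> with \<open>321\<close> and \<open>213\<close> with \<open>231\<close>, and
  \<open>a b r \<mapsto> b a (rev r)\<close> exchanges \<open>123\<close> with \<open>213\<close>, so only \<open>q = 123\<close> has to be counted. There the
  first entry of \<open>r\<close> forces \<open>r\<close> to consist of a decreasing run of small entries followed by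
  a decreasing run of large entries. For each of the \<open>n - 2\<close> possible shapes of \<open>r\<close>, each of \<open>a\<close> and \<open>b\<close>
  lies either between the two runs or above both. Only the order \<open>a < b\<close> with both between the runs
  is excluded by \<open>a b x\<close>, which leaves five of six choices.
\<close>

section \<open>Forbidden triples in a list\<close>

fun no_triple :: "('a \<Rightarrow> 'a \<Rightarrow> 'a \<Rightarrow> bool) \<Rightarrow> 'a list \<Rightarrow> bool" where
  "no_triple P [] \<longleftrightarrow> True"
| "no_triple P (x # xs) \<longleftrightarrow> sorted_wrt (\<lambda>y z. \<not> P x y z) xs \<and> no_triple P xs"

text \<open>Links the recursive form, which the simplifier unfolds along the list, to the positions
  that occur in pattern containment.\<close>

lemma no_triple_nth:
  "no_triple P xs \<longleftrightarrow>
     (\<forall>i j k. i < j \<and> j < k \<and> k < length xs \<longrightarrow> \<not> P (xs ! i) (xs ! j) (xs ! k))"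
proof (induction xs)
  case (Cons x xs)
  have "(\<forall>i j k. i < j \<and> j < k \<and> k < length (x # xs) \<longrightarrow>
           \<not> P ((x # xs) ! i) ((x # xs) ! j) ((x # xs) ! k)) \<longleftrightarrow>
        (\<forall>j k. j < k \<and> k < length xs \<longrightarrow> \<not> P x (xs ! j) (xs ! k)) \<and>
        (\<forall>i j k. i < j \<and> j < k \<and> k < length xs \<longrightarrow> \<not> P (xs ! i) (xs ! j) (xs ! k))"
    (is "?L \<longleftrightarrow> ?R1 \<and> ?R2")
  proof (intro iffI conjI)
    assume L: ?L
    show ?R1
      using L[rule_format, of 0 "Suc _" "Suc _"] by simp
    show ?R2
      using L[rule_format, of "Suc _" "Suc _" "Suc _"] by simp
  next
    assume R: "?R1 \<and> ?R2"
    show ?L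
    proof (intro allI impI)
      fix i j k assume "i < j \<and> j < k \<and> k < length (x # xs)"
      then obtain j' k' where "j = Suc j'" "k = Suc k'" "j' < k'" "k' < length xs" "i < Suc j'"
        by (cases j; cases k) auto
      then show "\<not> P ((x # xs) ! i) ((x # xs) ! j) ((x # xs) ! k)"
        using R by (cases i) auto
    qed
  qed
  moreover have "sorted_wrt (\<lambda>y z. \<not> P x y z) xs \<longleftrightarrow>
      (\<forall>j k. j < k \<and> k < length xs \<longrightarrow> \<not> P x (xs ! j) (xs ! k))"
    by (auto simp: sorted_wrt_iff_nth_less)
  ultimately show ?case
    by (simp only: no_triple.simps Cons.IH)
qed simp

text \<open>Rotation moves entries to the end; splitting there isolates the triples that contain a
  moved entry.\<close>

lemma no_triple_snoc:
  "no_triple P (xs @ [z]) \<longleftrightarrow> no_triple P xs \<and> sorted_wrt (\<lambda>x y. \<not> P x y z) xs"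
  by (induction xs) (auto simp: sorted_wrt_append)

lemma no_triple_rev: "no_triple P (rev xs) \<longleftrightarrow> no_triple (\<lambda>x y z. P z y x) xs"
  by (induction xs) (auto simp: no_triple_snoc sorted_wrt_rev)

lemma no_triple_map: "no_triple P (map f xs) \<longleftrightarrow> no_triple (\<lambda>x y z. P (f x) (f y) (f z)) xs"
  by (induction xs) (auto simp: sorted_wrt_map)

lemma no_triple_conj:
  "no_triple (\<lambda>x y z. P x y z \<or> Q x y z) xs \<longleftrightarrow> no_triple P xs \<and> no_triple Q xs"
  unfolding no_triple_nth by blast

text \<open>Entries at different positions of \<open>p\<close> differ, so \<open>P\<close> has to
  match the table of comparisons only on distinct values. This lets a short form such as
  \<open>x < y \<and> y < z\<close> replace the table.\<close>

lemma avoids_iff_no_triple: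
  assumes "distinct p"
    and P: "\<And>x y z. \<lbrakk>x \<noteq> y; x \<noteq> z; y \<noteq> z\<rbrakk> \<Longrightarrow> P x y z \<longleftrightarrow>
      (x < y \<longleftrightarrow> q\<^sub>0 < q\<^sub>1) \<and> (x < z \<longleftrightarrow> q\<^sub>0 < q\<^sub>2) \<and> (y < z \<longleftrightarrow> q\<^sub>1 < q\<^sub>2)"
  shows "avoids p [q\<^sub>0, q\<^sub>1, q\<^sub>2] \<longleftrightarrow> no_triple P p"
proof -
  let ?I = "\<lambda>i j k. (p ! i < p ! j \<longleftrightarrow> q\<^sub>0 < q\<^sub>1) \<and> (p ! i < p ! k \<longleftrightarrow> q\<^sub>0 < q\<^sub>2) \<and> (p ! j < p ! k \<longleftrightarrow> q\<^sub>1 < q\<^sub>2)"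
  have "contains_pattern p [q\<^sub>0, q\<^sub>1, q\<^sub>2] \<longleftrightarrow> (\<exists>i j k. i < j \<and> j < k \<and> k < length p \<and> ?I i j k)"
  proof
    assume "contains_pattern p [q\<^sub>0, q\<^sub>1, q\<^sub>2]"
    then obtain f where f: "strict_mono_on {..<3} f" "f ` {..<3} \<subseteq> {..<length p}"
      "\<And>a b. a < b \<Longrightarrow> b < 3 \<Longrightarrow> p ! f a < p ! f b \<longleftrightarrow> [q\<^sub>0, q\<^sub>1, q\<^sub>2] ! a < [q\<^sub>0, q\<^sub>1, q\<^sub>2] ! b"
      unfolding contains_pattern_def by (auto simp: numeral_3_eq_3)
    have "f 0 < f 1" "f 1 < f 2"
      using f(1) by (auto simp: strict_mono_on_def)
    moreover have "f 2 < length p"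
      using f(2) by (simp add: image_subset_iff)
    moreover have "?I (f 0) (f 1) (f 2)"
      using f(3)[of 0 1] f(3)[of 0 2] f(3)[of 1 2] by simp
    ultimately show "\<exists>i j k. i < j \<and> j < k \<and> k < length p \<and> ?I i j k"
      by blast
  next
    assume "\<exists>i j k. i < j \<and> j < k \<and> k < length p \<and> ?I i j k"
    then obtain i j k where ijk: "i < j" "j < k" "k < length p" "?I i j k"
      by blast
    define f where "f = (!) [i, j, k]"
    have less3: "a < Suc (Suc (Suc 0)) \<longleftrightarrow> a = 0 \<or> a = 1 \<or> a = 2" for a :: nat
      by auto
    have "strict_mono_on {..<3} f" "f ` {..<3} \<subseteq> {..<length p}"
      using ijk by (auto simp: f_def strict_mono_on_def numeral_3_eq_3 less3)
    moreover have "p ! f a < p ! f b \<longleftrightarrow> [q\<^sub>0, q\<^sub>1, q\<^sub>2] ! a < [q\<^sub>0, q\<^sub>1, q\<^sub>2] ! b" if "a < b" "b < 3" for a b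
    proof -
      have "a = 0 \<and> b = 1 \<or> a = 0 \<and> b = 2 \<or> a = 1 \<and> b = 2"
        using that by linarith
      then show ?thesis
        using ijk(4) by (auto simp: f_def)
    qed
    ultimately show "contains_pattern p [q\<^sub>0, q\<^sub>1, q\<^sub>2]"
      unfolding contains_pattern_def by (intro exI[of _ f]) (simp add: numeral_3_eq_3)
  qed
  moreover have "?I i j k \<longleftrightarrow> P (p ! i) (p ! j) (p ! k)" if "i < j" "j < k" "k < length p" for i j k
    using that \<open>distinct p\<close> by (subst P) (auto simp: nth_eq_iff_index_eq)
  ultimately show ?thesis
    unfolding avoids_def no_triple_nth by blast
qed

section \<open>The three avoidance conditions as one condition on triples\<close>

fun good :: "('a \<Rightarrow> 'a \<Rightarrow> 'a \<Rightarrow> bool) \<Rightarrow> 'a list \<Rightarrow> bool" where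
  "good P (a # b # r) \<longleftrightarrow>
     (\<forall>x\<in>set r. \<not> P a b x) \<and>
     sorted_wrt (\<lambda>x y. \<not> P a x y \<and> \<not> P y a x) r \<and>
     sorted_wrt (\<lambda>x y. \<not> P b x y \<and> \<not> P y b x) r \<and>
     no_triple (\<lambda>x y z. P x y z \<or> P z x y \<or> P y z x) r"
| "good P _ \<longleftrightarrow> True"

lemma sorted_wrt_conj:
  "sorted_wrt (\<lambda>x y. P x y \<and> Q x y) xs \<longleftrightarrow> sorted_wrt P xs \<and> sorted_wrt Q xs"
  by (induction xs) auto

text \<open>Each triple is read in its original order. For \<open>a x y\<close> the first two lists
  forbid \<open>P a x y\<close> and the third forbids \<open>P y a x\<close>; for
  \<open>b x y\<close> the first forbids \<open>P b x y\<close> and the other two forbid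
  \<open>P y b x\<close>. For \<open>a b x\<close> all three forbid \<open>P a b x\<close>, and a
  triple inside \<open>r\<close> meets three different conditions.\<close>

lemma good_iff:
  "good P (a # b # r) \<longleftrightarrow> no_triple P (a # b # r) \<and> no_triple (\<lambda>x y z. P z x y) (b # r @ [a]) \<and>
     no_triple (\<lambda>x y z. P y z x) (r @ [a, b])"
proof -
  have "no_triple Q (r @ [a, b]) \<longleftrightarrow> no_triple Q (r @ [a]) \<and> sorted_wrt (\<lambda>x y. \<not> Q x y b) (r @ [a])"
    for Q
    using no_triple_snoc[of Q "r @ [a]" b] by simp
  then show ?thesis
    by (auto simp: no_triple_snoc no_triple_conj sorted_wrt_conj sorted_wrt_append)
qed

section \<open>Symmetries of the condition\<close>

fun swap_rev :: "'a list \<Rightarrow> 'a list" where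
  "swap_rev (a # b # r) = b # a # rev r"
| "swap_rev p = p"

lemma good_map: "good P (map f p) \<longleftrightarrow> good (\<lambda>x y z. P (f x) (f y) (f z)) p"
  by (cases p rule: swap_rev.cases) (simp_all add: sorted_wrt_map no_triple_map)

lemma swap_rev_swap_rev [simp]: "swap_rev (swap_rev p) = p"
  by (cases p rule: swap_rev.cases) auto

text \<open>Reversing \<open>r\<close> and exchanging the first two arguments of \<open>P\<close>
  interchanges the two conditions on \<open>a x y\<close>, likewise those on \<open>b x y\<close>,
  and permutes the three conditions inside \<open>r\<close>. The condition on \<open>a b x\<close>
  is kept because \<open>a\<close> and \<open>b\<close> are swapped too.\<close>

lemma good_swap_rev: "good (\<lambda>x y z. P y x z) (swap_rev p) \<longleftrightarrow> good P p"
proof -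
  have "(\<lambda>x y z. P y z x \<or> P z x y \<or> P x y z) = (\<lambda>x y z. P x y z \<or> P z x y \<or> P y z x)"
    by blast
  then show ?thesis
    by (cases p rule: swap_rev.cases) (auto simp: sorted_wrt_rev no_triple_rev conj_commute disj_ac)
qed

lemma Sym_iff: "p \<in> Sym n \<longleftrightarrow> distinct p \<and> set p = {1..n}"
  by (auto simp: Sym_def permutations_of_set_def)

lemma length_Sym: "p \<in> Sym n \<Longrightarrow> length p = n"
  using distinct_card[of p] by (simp add: Sym_iff)

lemma swap_rev_Sym: "p \<in> Sym n \<Longrightarrow> swap_rev p \<in> Sym n"
  by (cases p rule: swap_rev.cases) (auto simp: Sym_iff)

lemma complement_Sym:
  assumes "p \<in> Sym n" shows "map (\<lambda>x. Suc n - x) p \<in> Sym n"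
proof -
  have "(\<lambda>x. Suc n - x) ` {1..n} = {1..n}"
  proof (intro equalityI subsetI)
    fix x assume "x \<in> {1..n}"
    then show "x \<in> (\<lambda>x. Suc n - x) ` {1..n}"
      by (intro image_eqI[of _ _ "Suc n - x"]) auto
  qed auto
  moreover have "inj_on (\<lambda>x. Suc n - x) {1..n}"
    by (auto simp: inj_on_def)
  ultimately show ?thesis
    using assms by (simp add: Sym_iff distinct_map)
qed

section \<open>From rotated patterns to the triple condition\<close>

lemma Sym3_avoiding_eq_good:
  assumes "n \<ge> 3"
    and P: "\<And>x y z. \<lbrakk>x \<noteq> y; x \<noteq> z; y \<noteq> z\<rbrakk> \<Longrightarrow> P x y z \<longleftrightarrow>
      (x < y \<longleftrightarrow> q\<^sub>0 < q\<^sub>1) \<and> (x < z \<longleftrightarrow> q\<^sub>0 < q\<^sub>2) \<and> (y < z \<longleftrightarrow> q\<^sub>1 < q\<^sub>2)"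
    and q: "distinct [q\<^sub>0, q\<^sub>1, q\<^sub>2]"
  shows "Sym3_avoiding n [q\<^sub>0, q\<^sub>1, q\<^sub>2] (rotation 2 [q\<^sub>0, q\<^sub>1, q\<^sub>2]) (rotation 3 [q\<^sub>0, q\<^sub>1, q\<^sub>2]) =
         {p \<in> Sym n. good P p}"
proof -
  \<comment> \<open>Moving an entry past the others reverses its comparisons, both in the triple and
    in the pattern; for distinct values the two reversals cancel.\<close>
  have flip: "u < v \<longleftrightarrow> \<not> v < u" if "u \<noteq> v" for u v :: nat
    using that by auto
  have "avoids (rotation 1 p) [q\<^sub>0, q\<^sub>1, q\<^sub>2] \<and> avoids (rotation 2 p) [q\<^sub>1, q\<^sub>2, q\<^sub>0] \<and>
      avoids (rotation 3 p) [q\<^sub>2, q\<^sub>0, q\<^sub>1] \<longleftrightarrow> good P p" if p: "p \<in> Sym n" for p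
  proof -
    obtain a b r where abr: "p = a # b # r"
      using length_Sym[OF p] \<open>n \<ge> 3\<close> by (cases p rule: swap_rev.cases) auto
    have d: "distinct p"
      using p by (simp add: Sym_iff)
    have rot: "rotation 1 p = p" "rotation 2 p = b # r @ [a]" "rotation 3 p = r @ [a, b]"
      by (simp_all add: rotation_def abr numeral_2_eq_2)
    have "avoids (rotation 1 p) [q\<^sub>0, q\<^sub>1, q\<^sub>2] \<longleftrightarrow> no_triple P p"
      unfolding rot by (rule avoids_iff_no_triple[OF d P])
    moreover have "avoids (rotation 2 p) [q\<^sub>1, q\<^sub>2, q\<^sub>0] \<longleftrightarrow> no_triple (\<lambda>x y z. P z x y) (b # r @ [a])"
      unfolding rot
    proof (intro avoids_iff_no_triple)
      fix x y z :: nat assume "x \<noteq> y" "x \<noteq> z" "y \<noteq> z"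
      then show "P z x y \<longleftrightarrow> (x < y \<longleftrightarrow> q\<^sub>1 < q\<^sub>2) \<and> (x < z \<longleftrightarrow> q\<^sub>1 < q\<^sub>0) \<and> (y < z \<longleftrightarrow> q\<^sub>2 < q\<^sub>0)"
        using P[of z x y] q flip[of z x] flip[of z y] flip[of q\<^sub>0 q\<^sub>1] flip[of q\<^sub>0 q\<^sub>2] by simp blast
    qed (use d abr in auto)
    moreover have "avoids (rotation 3 p) [q\<^sub>2, q\<^sub>0, q\<^sub>1] \<longleftrightarrow> no_triple (\<lambda>x y z. P y z x) (r @ [a, b])"
      unfolding rot
    proof (intro avoids_iff_no_triple)
      fix x y z :: nat assume "x \<noteq> y" "x \<noteq> z" "y \<noteq> z"
      then show "P y z x \<longleftrightarrow> (x < y \<longleftrightarrow> q\<^sub>2 < q\<^sub>0) \<and> (x < z \<longleftrightarrow> q\<^sub>2 < q\<^sub>1) \<and> (y < z \<longleftrightarrow> q\<^sub>0 < q\<^sub>1)"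
        using P[of y z x] q flip[of z x] flip[of y x] flip[of q\<^sub>0 q\<^sub>2] flip[of q\<^sub>1 q\<^sub>2] by simp blast
    qed (use d abr in auto)
    ultimately show ?thesis
      by (simp only: abr good_iff)
  qed
  moreover have "rotation 2 [q\<^sub>0, q\<^sub>1, q\<^sub>2] = [q\<^sub>1, q\<^sub>2, q\<^sub>0]" "rotation 3 [q\<^sub>0, q\<^sub>1, q\<^sub>2] = [q\<^sub>2, q\<^sub>0, q\<^sub>1]"
    by (simp_all add: rotation_def numeral_2_eq_2)
  ultimately show ?thesis
    unfolding Sym3_avoiding_def by auto
qed

definition increasing :: "nat \<Rightarrow> nat \<Rightarrow> nat \<Rightarrow> bool" where
  "increasing x y z \<longleftrightarrow> x < y \<and> y < z"

section \<open>Equal counts under the symmetries\<close>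

lemma card_good_swap_rev:
  "card {p \<in> Sym n. good (\<lambda>x y z. P y x z) p} = card {p \<in> Sym n. good P p}"
proof (rule bij_betw_same_card, rule bij_betw_byWitness)
  show "swap_rev ` {p \<in> Sym n. good (\<lambda>x y z. P y x z) p} \<subseteq> {p \<in> Sym n. good P p}"
    using good_swap_rev[of "\<lambda>x y z. P y x z"] by (auto simp: swap_rev_Sym)
  show "swap_rev ` {p \<in> Sym n. good P p} \<subseteq> {p \<in> Sym n. good (\<lambda>x y z. P y x z) p}"
    by (auto simp: swap_rev_Sym good_swap_rev)
qed simp_all

lemma no_triple_cong:
  assumes "\<And>x y z. \<lbrakk>x \<in> set p; y \<in> set p; z \<in> set p\<rbrakk> \<Longrightarrow> P x y z \<longleftrightarrow> Q x y z"
  shows "no_triple P p \<longleftrightarrow> no_triple Q p"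
  using assms by (auto simp: no_triple_nth)

text \<open>By \<open>good_iff\<close> the condition is about three lists with the same entries, so
  \<open>no_triple_cong\<close> applies to each. The restriction to entries is what allows truncated
  subtraction in the complement.\<close>

lemma good_cong:
  assumes "\<And>x y z. \<lbrakk>x \<in> set p; y \<in> set p; z \<in> set p\<rbrakk> \<Longrightarrow> P x y z \<longleftrightarrow> Q x y z"
  shows "good P p \<longleftrightarrow> good Q p"
proof (cases p rule: swap_rev.cases)
  case (1 a b r)
  have "no_triple P (a # b # r) \<longleftrightarrow> no_triple Q (a # b # r)"
    by (rule no_triple_cong, rule assms) (simp_all add: 1)
  moreover have "no_triple (\<lambda>x y z. P z x y) (b # r @ [a]) \<longleftrightarrow> no_triple (\<lambda>x y z. Q z x y) (b # r @ [a])"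
    by (rule no_triple_cong, rule assms) (auto simp: 1)
  moreover have "no_triple (\<lambda>x y z. P y z x) (r @ [a, b]) \<longleftrightarrow> no_triple (\<lambda>x y z. Q y z x) (r @ [a, b])"
    by (rule no_triple_cong, rule assms) (auto simp: 1)
  ultimately show ?thesis
    by (simp only: 1 good_iff)
qed auto

lemma card_good_complement:
  assumes PQ: "\<And>x y z. \<lbrakk>x \<in> {1..n}; y \<in> {1..n}; z \<in> {1..n}\<rbrakk> \<Longrightarrow>
      P (Suc n - x) (Suc n - y) (Suc n - z) \<longleftrightarrow> Q x y z"
  shows "card {p \<in> Sym n. good Q p} = card {p \<in> Sym n. good P p}"
proof (rule bij_betw_same_card,
    rule bij_betw_byWitness[where f = "map (\<lambda>x. Suc n - x)" and f' = "map (\<lambda>x. Suc n - x)"])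
  let ?c = "map (\<lambda>x. Suc n - x)"
  have *: "good P (?c p) \<longleftrightarrow> good Q p" if "p \<in> Sym n" for p
    unfolding good_map using that PQ by (intro good_cong) (simp add: Sym_iff)
  have inv: "?c (?c p) = p" if "p \<in> Sym n" for p
    using that by (auto simp: Sym_iff intro!: map_idI)
  show "\<forall>p\<in>{p \<in> Sym n. good Q p}. ?c (?c p) = p" "\<forall>p\<in>{p \<in> Sym n. good P p}. ?c (?c p) = p"
    using inv by blast+
  show "?c ` {p \<in> Sym n. good Q p} \<subseteq> {p \<in> Sym n. good P p}"
    using * complement_Sym by blast
  show "?c ` {p \<in> Sym n. good P p} \<subseteq> {p \<in> Sym n. good Q p}"
    using *[OF complement_Sym] complement_Sym inv by auto
qed

section \<open>Two decreasing runs and their possible prefixes\<close>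

text \<open>
  Here \<open>k\<close> is the length of the lower run. A decreasing \<open>r\<close> is encoded by \<open>k = 0\<close>, so that the upper
  run is never empty and \<open>k\<close> ranges over \<open>{..<n - 2}\<close>.
\<close>

definition two_runs :: "nat \<Rightarrow> nat \<times> nat \<times> nat \<Rightarrow> nat list" where
  "two_runs n = (\<lambda>(a, b, k).
     a # b # rev [1..<Suc k] @ rev (filter (\<lambda>x. x \<noteq> a \<and> x \<noteq> b) [Suc k..<Suc n]))"

text \<open>The five choices per \<open>k\<close>: both leading entries above the upper run, in
  either order; one above and one between the runs, in either order; or both between the runs, in
  decreasing order only.\<close>

definition prefixes :: "nat \<Rightarrow> (nat \<times> nat \<times> nat) set" where
  "prefixes n = (\<Union>k<n - 2.
     {(n - 1, n, k), (n, n - 1, k), (k + 1, n, k), (n, k + 1, k), (k + 2, k + 1, k)})"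

text \<open>The last component separates different \<open>k\<close>. Since \<open>k < n - 2\<close>,
  the value \<open>k + 1\<close> is below \<open>n - 1\<close> and \<open>k + 2\<close> is below
  \<open>n\<close>, so the five triples are distinct.\<close>

lemma card_prefixes: "card (prefixes n) = 5 * (n - 2)"
proof -
  have "card (prefixes n) = (\<Sum>k<n - 2. card
     {(n - 1, n, k), (n, n - 1, k), (k + 1, n, k), (n, k + 1, k), (k + 2, k + 1, k)})"
    unfolding prefixes_def by (rule card_UN_disjoint) auto
  also have "\<dots> = (\<Sum>k<n - 2. 5)"
    by (rule sum.cong) (auto simp: card_insert_if)
  finally show ?thesis by simp
qed

lemma inj_on_two_runs: "inj_on (two_runs n) (prefixes n)"
proof (rule inj_onI)
  fix t t' assume t: "t \<in> prefixes n" "t' \<in> prefixes n" and eq: "two_runs n t = two_runs n t'"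
  obtain a b k a' b' k' where tt: "t = (a, b, k)" "t' = (a', b', k')"
    by (metis prod_cases3)
  have ab: "a' = a" "b' = b"
    using eq by (simp_all add: tt two_runs_def del: upt_Suc)
  have kn: "k < n - 2" "k' < n - 2"
    using t by (auto simp: tt prefixes_def)
  have "k = k'"
  proof (cases "{a, b} = {n - 1, n}")
    case True
    have E: "[Suc j..<Suc n] = [Suc j..<n - 1] @ [n - 1, n]" if "j < n - 2" for j
    proof -
      have "n = Suc (Suc (n - 2))"
        using that by simp
      then obtain m where "n = Suc (Suc m)" ..
      with that show ?thesis by simp
    qed
    have "two_runs n (a, b, j) = a # b # rev [1..<Suc j] @ rev [Suc j..<n - 1]" if "j < n - 2" for j
    proof -
      have "a \<in> {n - 1, n}" "b \<in> {n - 1, n}" "n - 1 \<in> {a, b}" "n \<in> {a, b}"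
        using True by blast+
      then have "filter (\<lambda>x. x \<noteq> a \<and> x \<noteq> b) [Suc j..<Suc n] = [Suc j..<n - 1]"
        unfolding E[OF that] by (auto simp: filter_id_conv)
      then show ?thesis
        by (simp add: two_runs_def)
    qed
    then have eq': "rev [1..<Suc k] @ rev [Suc k..<n - 1] = rev [1..<Suc k'] @ rev [Suc k'..<n - 1]"
      using eq kn by (simp add: tt ab)
    \<comment> \<open>The third entry of the permutation reveals \<open>j\<close>: it is
      \<open>j\<close> itself, or \<open>n - 2\<close> when the lower run is empty, and
      \<open>j < n - 2\<close> keeps these apart.\<close>
    have hd: "hd (rev [1..<Suc j] @ rev [Suc j..<n - 1]) = (if j = 0 then n - 2 else j)"
      if "j < n - 2" for j
    proof (cases "j = 0")
      case True
      have "rev [Suc 0..<Suc (n - 2)] = (n - 2) # rev [Suc 0..<n - 2]"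
        using that by simp
      moreover have "Suc (n - 2) = n - 1"
        using that by simp
      ultimately show ?thesis using True by simp
    qed simp
    show ?thesis
      using arg_cong[OF eq', of hd] kn unfolding hd[OF kn(1)] hd[OF kn(2)] by (auto split: if_splits)
  next
    \<comment> \<open>In the three remaining forms the smaller of \<open>a\<close> and
      \<open>b\<close> is \<open>k + 1\<close>.\<close>
    case False
    then show ?thesis
      using t by (auto simp: tt ab prefixes_def)
  qed
  then show "t = t'"
    by (simp add: tt ab)
qed

section \<open>Two-run permutations satisfy the condition\<close>

text \<open>The list is a cyclic shift of the decreasing list \<open>ys\<close> followed by
  \<open>xs\<close>, and the three forbidden orders are the cyclic shifts of an increasing
  triple.\<close>

lemma no_triple_two_runs:
  assumes "sorted_wrt (>) xs" "sorted_wrt (>) ys" "\<forall>x\<in>set xs. \<forall>y\<in>set ys. x < y"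
  shows "no_triple (\<lambda>x y z. increasing x y z \<or> increasing z x y \<or> increasing y z x) (xs @ ys)"
proof -
  have "no_triple (\<lambda>x y z. increasing x y z \<or> increasing z x y \<or> increasing y z x) ys"
    using assms(2)
  proof (induction ys)
    case (Cons y ys)
    then have ys: "sorted_wrt (>) ys" "\<forall>z\<in>set ys. z < y"
      by simp_all
    have "sorted_wrt (\<lambda>z w. \<not> (increasing y z w \<or> increasing w y z \<or> increasing z w y)) ys"
      by (rule sorted_wrt_mono_rel[OF _ ys(1)]) (use ys(2) in \<open>auto simp: increasing_def\<close>)
    with Cons show ?case
      by simp
  qed simp
  then show ?thesis
    using assms(1,3)
  proof (induction xs)
    case (Cons x xs)
    have xs: "sorted_wrt (>) xs"
      using Cons.prems(2) by simp
    have "sorted_wrt (\<lambda>y z. \<not> (increasing x y z \<or> increasing z x y \<or> increasing y z x)) (xs @ ys)"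
      unfolding sorted_wrt_append
    proof (intro conjI ballI)
      show "sorted_wrt (\<lambda>y z. \<not> (increasing x y z \<or> increasing z x y \<or> increasing y z x)) xs"
        by (rule sorted_wrt_mono_rel[OF _ xs]) (use Cons.prems(2) in \<open>auto simp: increasing_def\<close>)
      show "sorted_wrt (\<lambda>y z. \<not> (increasing x y z \<or> increasing z x y \<or> increasing y z x)) ys"
        by (rule sorted_wrt_mono_rel[OF _ assms(2)]) (use Cons.prems(3) in \<open>auto simp: increasing_def\<close>)
    next
      fix y z assume "y \<in> set xs" "z \<in> set ys"
      then show "\<not> (increasing x y z \<or> increasing z x y \<or> increasing y z x)"
        using Cons.prems(2) Cons.prems(3) by (auto simp: increasing_def)
    qed
    then show ?case
      using Cons by simp
  qed simp
qed

lemma sorted_wrt_partition: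
  assumes "sorted_wrt (\<lambda>x y. Q y \<longrightarrow> Q x) xs"
  shows "xs = filter Q xs @ filter (\<lambda>x. \<not> Q x) xs"
  using assms
proof (induction xs)
  case (Cons x xs)
  show ?case
  proof (cases "Q x")
    case False
    then have "filter Q xs = []" "filter (\<lambda>x. \<not> Q x) xs = xs"
      using Cons.prems by (auto simp: filter_empty_conv filter_id_conv)
    with False show ?thesis by simp
  qed (use Cons in simp)
qed simp

lemma decreasing_unique:
  fixes xs ys :: "'a :: linorder list"
  assumes "sorted_wrt (>) xs" "sorted_wrt (>) ys" "set xs = set ys"
  shows "xs = ys"
  using strict_sorted_equal[of "rev xs" "rev ys"] assms by (simp add: sorted_wrt_rev)

text \<open>Each of \<open>a\<close> and \<open>b\<close> exceeds the whole lower run and lies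
  entirely below or entirely above the upper run, so it never separates two entries of a run. If
  \<open>a < b\<close> then \<open>b = n\<close>, so no \<open>x\<close> completes
  \<open>a b x\<close>.\<close>

lemma two_runs_good:
  assumes "t \<in> prefixes n"
  shows "two_runs n t \<in> Sym n" "good increasing (two_runs n t)"
proof -
  obtain a b k where t: "t = (a, b, k)"
    by (metis prod_cases3)
  define xs where "xs = rev [1..<Suc k]"
  define ys where "ys = rev (filter (\<lambda>x. x \<noteq> a \<and> x \<noteq> b) [Suc k..<Suc n])"
  have p: "two_runs n t = a # b # xs @ ys"
    by (simp add: two_runs_def t xs_def ys_def)
  have k: "k < n - 2"
    and ab: "(a, b) \<in> {(n - 1, n), (n, n - 1), (k + 1, n), (n, k + 1), (k + 2, k + 1)}"
    using assms by (auto simp: t prefixes_def)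
  have set: "set xs = {1..k}" "set ys = {Suc k..n} - {a, b}"
    by (auto simp: xs_def ys_def simp del: upt_Suc)
  show "two_runs n t \<in> Sym n"
    unfolding Sym_iff
  proof
    show "set (two_runs n t) = {1..n}"
      using k ab unfolding p list.set set_append set by auto
    show "distinct (two_runs n t)"
      using k ab unfolding p distinct.simps distinct_append set_append set
      by (auto simp: xs_def ys_def simp del: upt_Suc)
  qed
  have sorted: "sorted_wrt (>) xs" "sorted_wrt (>) ys"
    by (simp_all add: xs_def ys_def sorted_wrt_rev sorted_wrt_filter del: upt_Suc)
  have "sorted_wrt (\<lambda>x y. \<not> increasing c x y \<and> \<not> increasing y c x) (xs @ ys)"
    if c: "c \<in> {a, b}" for c
    unfolding sorted_wrt_append
  proof (intro conjI ballI)
    show "sorted_wrt (\<lambda>x y. \<not> increasing c x y \<and> \<not> increasing y c x) xs"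
      by (rule sorted_wrt_mono_rel[OF _ sorted(1)]) (use c ab k in \<open>auto simp: set increasing_def\<close>)
    show "sorted_wrt (\<lambda>x y. \<not> increasing c x y \<and> \<not> increasing y c x) ys"
      by (rule sorted_wrt_mono_rel[OF _ sorted(2)]) (use c ab k in \<open>auto simp: set increasing_def\<close>)
    fix x y assume "x \<in> set xs" "y \<in> set ys"
    then show "\<not> increasing c x y" "\<not> increasing y c x"
      using c ab k by (auto simp: set increasing_def)
  qed
  moreover have "\<not> increasing a b x" if "x \<in> set (xs @ ys)" for x
    using that ab k by (auto simp: set increasing_def)
  moreover have "no_triple (\<lambda>x y z. increasing x y z \<or> increasing z x y \<or> increasing y z x) (xs @ ys)"
    using sorted by (rule no_triple_two_runs) (auto simp: set)
  ultimately show "good increasing (two_runs n t)"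
    by (simp add: p)
qed

section \<open>Every permutation satisfying the condition has two runs\<close>

lemma distinct_iff_sorted_wrt: "distinct xs \<longleftrightarrow> sorted_wrt (\<noteq>) xs"
  by (induction xs) auto

text \<open>In a decreasing list the order of positions is the reverse order of values, so a
  condition on positions becomes one on values.\<close>

lemma sorted_wrt_decreasingD:
  fixes xs :: "'a :: linorder list"
  assumes "sorted_wrt (>) xs" "sorted_wrt R xs" "x \<in> set xs" "y \<in> set xs" "y < x"
  shows "R x y"
  using assms by (induction xs) auto

text \<open>The first entry \<open>c\<close> of \<open>r\<close> splits \<open>r\<close> into the
  entries up to \<open>c\<close> and those above. If the second part is empty, \<open>r\<close> is
  decreasing and \<open>k = 0\<close>; otherwise the first part is all of \<open>{1..c}\<close> and
  \<open>k = c\<close>.\<close>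

lemma good_obtains_two_runs:
  assumes "n \<ge> 3" "p \<in> Sym n" "good increasing p"
  obtains t where "t \<in> prefixes n" "p = two_runs n t"
proof -
  have "length p \<ge> 3"
    using assms length_Sym by simp
  then obtain a b c s where p: "p = a # b # c # s"
    by (metis One_nat_def Suc_le_length_iff numeral_3_eq_3)
  define r where "r = c # s"
  have d: "distinct r" "a \<notin> set r" "b \<notin> set r" "a \<noteq> b" and sr: "set r = {1..n} - {a, b}"
    and ab: "a \<in> {1..n}" "b \<in> {1..n}" and c: "c \<in> {1..n}" "c \<noteq> a" "c \<noteq> b"
    using assms(2) unfolding Sym_iff p r_def by auto
  have abx: "\<not> (a < b \<and> b < x)" if "x \<in> set r" for x
    using assms(3) that by (auto simp: p r_def increasing_def)
  have s: "sorted_wrt (\<lambda>x y. \<not> (c < x \<and> x < y) \<and> \<not> (y < c \<and> c < x) \<and> \<not> (x < y \<and> y < c)) s"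
    using assms(3) by (simp add: p increasing_def)
  have a: "sorted_wrt (\<lambda>x y. \<not> increasing a x y \<and> \<not> increasing y a x) r"
    and b: "sorted_wrt (\<lambda>x y. \<not> increasing b x y \<and> \<not> increasing y b x) r"
    using assms(3) by (simp_all add: p r_def)
  define xs where "xs = filter (\<lambda>x. x \<le> c) r"
  define ys where "ys = filter (\<lambda>x. \<not> x \<le> c) r"
  have "sorted_wrt (\<noteq>) s"
    using d(1) by (simp add: r_def distinct_iff_sorted_wrt)
  then have s': "sorted_wrt (\<lambda>x y. x \<noteq> y \<and>
      \<not> (c < x \<and> x < y) \<and> \<not> (y < c \<and> c < x) \<and> \<not> (x < y \<and> y < c)) s"
    using s by (simp add: sorted_wrt_conj)
  have cs: "c \<notin> set s"
    using d(1) by (simp add: r_def)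
  \<comment> \<open>An entry above \<open>c\<close> followed by one below \<open>c\<close> would be
    the excluded case \<open>y < c < x\<close>.\<close>
  have "sorted_wrt (\<lambda>x y. y \<le> c \<longrightarrow> x \<le> c) s"
    by (rule sorted_wrt_mono_rel[OF _ s']) (metis cs le_neq_implies_less not_less)
  then have r: "r = xs @ ys"
    unfolding xs_def ys_def by (intro sorted_wrt_partition) (simp add: r_def)
  \<comment> \<open>On one side of \<open>c\<close> an ascent would be the excluded
    \<open>c < x < y\<close> or \<open>x < y < c\<close>.\<close>
  have "sorted_wrt (\<lambda>x y. (x \<le> c \<longleftrightarrow> y \<le> c) \<longrightarrow> x > y) s"
    by (rule sorted_wrt_mono_rel[OF _ s']) (metis cs le_neq_implies_less nat_neq_iff not_less)
  then have r': "sorted_wrt (\<lambda>x y. (x \<le> c \<longleftrightarrow> y \<le> c) \<longrightarrow> x > y) r"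
    using cs by (auto simp: r_def order.order_iff_strict)
  have xs: "sorted_wrt (>) xs"
    unfolding xs_def by (rule sorted_wrt_mono_rel[OF _ sorted_wrt_filter[OF r']]) auto
  have ys: "sorted_wrt (>) ys"
    unfolding ys_def by (rule sorted_wrt_mono_rel[OF _ sorted_wrt_filter[OF r']]) auto
  have mem: "x \<in> set r \<longleftrightarrow> 1 \<le> x \<and> x \<le> n \<and> x \<noteq> a \<and> x \<noteq> b" for x
    using sr by auto
  \<comment> \<open>This is the condition on \<open>e\<close>, \<open>c\<close> and a later entry
    \<open>y\<close> of \<open>r\<close>.\<close>
  have not_between: "\<not> (e < c \<and> c < y)" "\<not> (y < e \<and> e < c)" if "e \<in> {a, b}" "y \<in> set r" for e y
    using that a b by (auto simp: r_def increasing_def)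
  \<comment> \<open>Neither \<open>a\<close> nor \<open>b\<close> may separate two values of the
    upper run.\<close>
  have convex: "\<not> (y < e \<and> e < x)"
    if "e \<in> {a, b}" "c < y" "x \<le> n" "x \<notin> {a, b}" "y \<notin> {a, b}" for e x y
  proof
    assume "y < e \<and> e < x"
    have "sorted_wrt (\<lambda>x y. \<not> increasing e x y \<and> \<not> increasing y e x) ys"
      using that(1) a b unfolding ys_def by (auto intro: sorted_wrt_filter)
    moreover have "x \<in> set ys" "y \<in> set ys" "y < x"
      using that \<open>y < e \<and> e < x\<close> by (auto simp: ys_def mem)
    ultimately have "\<not> increasing y e x"
      using sorted_wrt_decreasingD[OF ys] by blast
    then show False
      using \<open>y < e \<and> e < x\<close> by (simp add: increasing_def)
  qed
  show thesis
  proof (cases "\<forall>x\<in>set r. x \<le> c")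
    case True
    then have "xs = r"
      by (simp add: xs_def)
    then have "r = rev (filter (\<lambda>x. x \<noteq> a \<and> x \<noteq> b) [1..<Suc n])"
      using xs by (intro decreasing_unique) (auto simp: less_Suc_eq_le sorted_wrt_rev mem sorted_wrt_filter simp del: upt_Suc)
    then have p0: "p = two_runs n (a, b, 0)"
      by (simp add: p r_def two_runs_def)
    have "(a, b) \<in> {(n - 1, n), (n, n - 1), (1, n), (n, 1), (2, 1)}"
    proof -
      \<comment> \<open>With \<open>c\<close> the maximum of \<open>r\<close>, all values above
        \<open>c\<close> are taken by \<open>a\<close> and \<open>b\<close>. By
        \<open>not_between\<close>, so are all values below an \<open>e < c\<close> from
        \<open>{a, b}\<close>.\<close>
      have max: "x \<in> {a, b}" if "c < x" "x \<le> n" for x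
        using True[rule_format, of x] mem[of x] c(1) that by auto
      have min: "y \<in> {a, b}" if "e \<in> {a, b}" "e < c" "1 \<le> y" "y < e" for e y
        using not_between(2)[of e y] mem[of y] that ab by auto
      have min_b: "b = y" if "a < c" "1 \<le> y" "y < a" for y
        using min[OF _ that] that(3) by simp
      have min_a: "a = y" if "b < c" "1 \<le> y" "y < b" for y
        using min[OF _ that] that(3) by simp
      have bounds: "1 \<le> a" "1 \<le> b" "a \<le> n" "b \<le> n" "c \<le> n"
        using ab c by auto
      consider "a < c" "b < c" | "a < c" "c < b" | "c < a" "b < c" | "c < a" "c < b"
        using c(2,3) by linarith
      then show ?thesis
      proof cases
        case 1
        \<comment> \<open>Taking \<open>x = c\<close> in \<open>abx\<close> rules out
          \<open>a < b < c\<close>.\<close>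
        then have "b < a"
          using abx[of c] d(4) by (auto simp: r_def)
        moreover from this have "b = 1"
          using 1 min_b[of 1] bounds by linarith
        ultimately have "a = 2"
          using 1 min_b[of 2] by linarith
        with \<open>b = 1\<close> show ?thesis by simp
      next
        case 2
        then have "a = 1" "b = n"
          using min_b[of 1] max[of n] bounds by force+
        then show ?thesis by simp
      next
        case 3
        then have "b = 1" "a = n"
          using min_a[of 1] max[of n] bounds by force+
        then show ?thesis by simp
      next
        case 4
        then have "c < n - 1" "c < n"
          using bounds d(4) by linarith+
        then have "n - 1 \<in> {a, b}" "n \<in> {a, b}"
          using max by simp_all
        moreover have "n \<noteq> n - 1"
          using assms(1) by simp
        ultimately show ?thesis by auto
      qed
    qed
    then have "(a, b, 0) \<in> prefixes n"
      using assms(1) by (auto simp: prefixes_def intro!: bexI[of _ 0])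
    with p0 show ?thesis
      by (rule that[rotated])
  next
    case False
    then obtain z where z: "z \<in> set r" "c < z"
      by auto
    \<comment> \<open>An \<open>e\<close> below \<open>c\<close> would give
      \<open>e < c < z\<close>.\<close>
    have ca: "c < a" "c < b"
      using not_between(1)[of _ z] z c by (metis insertCI nat_neq_iff)+
    have "xs = rev [1..<Suc c]"
      using xs ca c by (intro decreasing_unique) (auto simp: sorted_wrt_rev mem xs_def simp del: upt_Suc)
    moreover have "ys = rev (filter (\<lambda>x. x \<noteq> a \<and> x \<noteq> b) [Suc c..<Suc n])"
      using ys by (intro decreasing_unique)
        (auto simp: sorted_wrt_rev mem ys_def sorted_wrt_filter simp del: upt_Suc)
    ultimately have "p = two_runs n (a, b, c)"
      using r by (simp add: p r_def two_runs_def)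
    moreover have "(a, b, c) \<in> prefixes n"
    proof -
      have "z \<le> n" "z \<noteq> a" "z \<noteq> b" "a \<le> n" "b \<le> n"
        using z(1) ab by (simp_all add: mem)
      \<comment> \<open>The three distinct values \<open>a\<close>, \<open>b\<close> and
        \<open>z\<close> lie above \<open>c\<close> and are at most \<open>n\<close>.\<close>
      then have "c < n - 2"
        using ca z(2) d(4) by linarith
      have "(a, b) \<in> {(n - 1, n), (n, n - 1), (c + 1, n), (n, c + 1), (c + 2, c + 1)}"
      proof -
        \<comment> \<open>If \<open>a < b < n\<close>, then \<open>n\<close> lies in
          \<open>r\<close> and completes \<open>a b n\<close>.\<close>
        have *: "a < b \<Longrightarrow> b = n" "a \<le> n" "b \<le> n"
          using abx[of n] mem[of n] ab assms(1) by auto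
        have "n - 1 \<noteq> n"
          using assms(1) by simp
        consider "a = n" "b < n" | "b = n" "a < n" | "b < a" "a < n"
          using * d(4) by linarith
        then show ?thesis
        proof cases
          case 1
          \<comment> \<open>Otherwise \<open>c + 1\<close> and \<open>n - 1\<close> both belong to
            the upper run and \<open>b\<close> separates them.\<close>
          have "b = n - 1 \<or> b = c + 1"
          proof (rule ccontr)
            assume "\<not> (b = n - 1 \<or> b = c + 1)"
            then have "b < n - 1" "c + 1 < b"
              using 1 ca \<open>c < n - 2\<close> by linarith+
            then show False
              using convex[of b "c + 1" "n - 1"] \<open>n - 1 \<noteq> n\<close> 1 ca \<open>c < n - 2\<close> by simp
          qed
          with 1 show ?thesis by auto
        next
          case 2
          have "a = n - 1 \<or> a = c + 1"
          proof (rule ccontr)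
            assume "\<not> (a = n - 1 \<or> a = c + 1)"
            then have "a < n - 1" "c + 1 < a"
              using 2 ca \<open>c < n - 2\<close> by linarith+
            then show False
              using convex[of a "c + 1" "n - 1"] \<open>n - 1 \<noteq> n\<close> 2 ca \<open>c < n - 2\<close> by simp
          qed
          with 2 show ?thesis by auto
        next
          case 3
          have "b = c + 1"
          proof (rule ccontr)
            assume "\<not> (b = c + 1)"
            then have "c + 1 < b" "c + 1 < a"
              using 3 ca \<open>c < n - 2\<close> by linarith+
            \<comment> \<open>Both \<open>c + 1\<close> and \<open>n\<close> are in the upper run
              here, and \<open>a\<close> separates them.\<close>
            then show False
              using convex[of a "c + 1" n] 3 ca \<open>c < n - 2\<close> by simp
          qed
          moreover have "a = c + 2"
          proof (rule ccontr)
            assume "\<not> (a = c + 2)"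
            then have "c + 2 < a"
              using 3 \<open>b = c + 1\<close> ca \<open>c < n - 2\<close> by linarith+
            then show False
              using convex[of a "c + 2" n] 3 \<open>b = c + 1\<close> ca \<open>c < n - 2\<close> by simp
          qed
          ultimately show ?thesis by simp
        qed
      qed
      with \<open>c < n - 2\<close> show ?thesis
        unfolding prefixes_def by (intro UN_I[of c]) auto
    qed
    ultimately show ?thesis
      by (rule that[rotated])
  qed
qed

section \<open>The count for \<open>123\<close> and its transfer to the other patterns\<close>

lemma card_good_increasing:
  assumes "n \<ge> 3"
  shows "card {p \<in> Sym n. good increasing p} = 5 * n - 10"
proof -
  have "{p \<in> Sym n. good increasing p} = two_runs n ` prefixes n"
  proof (intro equalityI subsetI)
    fix p assume "p \<in> {p \<in> Sym n. good increasing p}"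
    then show "p \<in> two_runs n ` prefixes n"
      using good_obtains_two_runs[OF assms] by blast
  qed (auto simp: two_runs_good)
  then show ?thesis
    by (simp add: card_image[OF inj_on_two_runs] card_prefixes diff_mult_distrib2)
qed

theorem theorem4p3:
  fixes n :: nat and q :: "nat list"
  assumes "n \<ge> 3"
    and "q \<in> {[1,2,3], [3,2,1], [2,1,3], [2,3,1]}"
  shows "card (Sym3_avoiding n q (rotation 2 q) (rotation 3 q)) = 5 * n - 10"
proof -
  let ?A = "\<lambda>q. Sym3_avoiding n q (rotation 2 q) (rotation 3 q)"
  note count = card_good_increasing[OF assms(1)]
  have "?A [1,2,3] = {p \<in> Sym n. good increasing p}"
    by (intro Sym3_avoiding_eq_good) (use assms(1) in \<open>auto simp: increasing_def\<close>)
  moreover have "?A [2,1,3] = {p \<in> Sym n. good (\<lambda>x y z. increasing y x z) p}"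
    by (intro Sym3_avoiding_eq_good) (use assms(1) in \<open>auto simp: increasing_def\<close>)
  moreover have "?A [3,2,1] = {p \<in> Sym n. good (\<lambda>x y z. increasing z y x) p}"
    by (intro Sym3_avoiding_eq_good) (use assms(1) in \<open>auto simp: increasing_def\<close>)
  moreover have "?A [2,3,1] = {p \<in> Sym n. good (\<lambda>x y z. increasing z x y) p}"
    by (intro Sym3_avoiding_eq_good) (use assms(1) in \<open>auto simp: increasing_def\<close>)
  moreover have "card {p \<in> Sym n. good (\<lambda>x y z. increasing y x z) p} = 5 * n - 10"
    using card_good_swap_rev count by metis
  moreover have "card {p \<in> Sym n. good (\<lambda>x y z. increasing z y x) p} =
      card {p \<in> Sym n. good increasing p}"
    by (rule card_good_complement) (auto simp: increasing_def)
  \<comment> \<open>Complementing turns \<open>z < x < y\<close> into \<open>y < x < z\<close>, so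
    \<open>231\<close> is reduced to \<open>213\<close>, already counted by swapping.\<close>
  moreover have "card {p \<in> Sym n. good (\<lambda>x y z. increasing z x y) p} =
      card {p \<in> Sym n. good (\<lambda>x y z. increasing y x z) p}"
    by (rule card_good_complement) (auto simp: increasing_def)
  ultimately show ?thesis
    using assms(2) count by auto
qed

end
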